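(* Assume the following three hypotheses. (i) For every $\lambda\in\,]-2,2[$ and every $(a_0,a_1)\in\mathbb{Z}^2$, the integer sequence defined by $0\le a_{n+2}+\lambda a_{n+1}+a_n<1$ ($n\ge0$) is periodic. (ii) For every irreducible fraction $p/q\in\,]-2,2[$ ($q\ge1$), every orbit in $\mathbb{Z}^2$ of the map $$F^+_{p/q}(x,y)=\begin{cases}\bigl(y,\;1+\lceil -\tfrac pq y-x\rceil\bigr) & \text{if } y<0 \text{ and } y\equiv 0 \pmod q,\\ \bigl(y,\;\lceil -\tfrac pq y-x\rceil\bigr) & \text{otherwise}\end{cases}$$ is periodic. (iii) For every irreducible fraction $p/q\in\,]-2,2[$ ($q\ge1$), every orbit in $\mathbb{Z}^2$ of the map $$F^-_{p/q}(x,y)=\begin{cases}\bigl(y,\;1+\lceil -\tfrac pq y-x\rceil\bigr) & \text{if } y>0 \text{ and } y\equiv 0 \pmod q,\\ \bigl(y,\;\lceil -\tfrac pq y-x\rceil\bigr) & \text{otherwise}\end{cases}$$ is periodic. Then for any $(a_0,a_1)\in\mathbb{Z}^2$ and any $\varepsilon>0$ there exist finitely many non-empty intervals $I_j$ such that: $[-2+\varepsilon,2[\,=\bigsqcup_j I_j$ (disjoint union); for all $\lambda$ in the same $I_j$, the period of the sequence $(a_n)$ defined by $0\le a_{n+2}+\lambda a_{n+1}+a_n<1$ with the given $a_0,a_1$ is identical; and if $\lambda\in I_j$, $\lambda'\in I_{j'}$ with $j\ne j'$, then the periods of this sequence for $\lambda$ and for $\lambda'$ are different.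
   Context: For real $\lambda$ the condition $0\le a_{n+2}+\lambda a_{n+1}+a_n<1$ with integer $a_{n+2}$ determines $a_{n+2}=-\lfloor\lambda a_{n+1}+a_n\rfloor$. The maps $F^{\pm}_{p/q}$ describe the limits, as $\eta\to+0$, of the sequences defined by $0\le b_{n+2}+(\tfrac pq\pm\eta)b_{n+1}+b_n<1$. "The period" of a periodic sequence refers to its repeating cycle (the block of terms that repeats). The intervals $I_j$ may be open, closed, semi-open, or singletons. *)

theory Defs
  imports "HOL-Analysis.Analysis" "HOL-Number_Theory.Cong"
begin

fun rot_seq :: "real \<Rightarrow> int \<Rightarrow> int \<Rightarrow> nat \<Rightarrow> int" where
  "rot_seq l a0 a1 0 = a0"
| "rot_seq l a0 a1 (Suc 0) = a1"
| "rot_seq l a0 a1 (Suc (Suc n)) =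
     - \<lfloor>l * real_of_int (rot_seq l a0 a1 (Suc n)) + real_of_int (rot_seq l a0 a1 n)\<rfloor>"

lemma rot_seq_unique:
  "a = rot_seq l a0 a1 \<longleftrightarrow>
     a 0 = a0 \<and> a 1 = a1 \<and>
     (\<forall>n. 0 \<le> real_of_int (a (n + 2)) + l * real_of_int (a (n + 1)) + real_of_int (a n) \<and>
          real_of_int (a (n + 2)) + l * real_of_int (a (n + 1)) + real_of_int (a n) < 1)"
  (is "?L \<longleftrightarrow> ?R")
proof
  assume a: ?L
  have "0 \<le> real_of_int (a (n + 2)) + l * real_of_int (a (n + 1)) + real_of_int (a n) \<and>
        real_of_int (a (n + 2)) + l * real_of_int (a (n + 1)) + real_of_int (a n) < 1" for n
  proof -
    have "a (n + 2) = - \<lfloor>l * real_of_int (a (n + 1)) + real_of_int (a n)\<rfloor>"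
      using a by simp
    then show ?thesis by linarith
  qed
  with a show ?R by simp
next
  assume r: ?R
  have step: "a (Suc (Suc n)) = - \<lfloor>l * real_of_int (a (Suc n)) + real_of_int (a n)\<rfloor>" for n
  proof -
    have "0 \<le> real_of_int (a (Suc (Suc n))) + l * real_of_int (a (Suc n)) + real_of_int (a n)"
      "real_of_int (a (Suc (Suc n))) + l * real_of_int (a (Suc n)) + real_of_int (a n) < 1"
      using r[THEN conjunct2, THEN conjunct2, rule_format, of n] by simp_all
    then show ?thesis by linarith
  qed
  have "a n = rot_seq l a0 a1 n" for n
    by (induction n rule: induct_nat_012) (use r step in auto)
  then show ?L by (rule ext)
qed

(* Periodicity from the first term on. The maps (a_n, a_(n+1)) to (a_(n+1), a_(n+2)) and
   Fplus, Fminus are bijections of Z^2, so ultimate periodicity would be equivalent. *)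
definition seq_periodic :: "(nat \<Rightarrow> 'a) \<Rightarrow> bool" where
  "seq_periodic s \<longleftrightarrow> (\<exists>T>0. \<forall>n. s (n + T) = s n)"

definition period_length :: "(nat \<Rightarrow> 'a) \<Rightarrow> nat" where
  "period_length s = (LEAST T. T > 0 \<and> (\<forall>n. s (n + T) = s n))"

(* The period is the repeating block itself, not merely its length.
   Meaningful only for periodic s. *)
definition period_block :: "(nat \<Rightarrow> 'a) \<Rightarrow> 'a list" where
  "period_block s = map s [0..<period_length s]"

definition Fplus :: "int \<Rightarrow> int \<Rightarrow> int \<times> int \<Rightarrow> int \<times> int" where
  "Fplus p q = (\<lambda>(x, y).
     if y < 0 \<and> [y = 0] (mod q)
     then (y, 1 + \<lceil>- (real_of_int p / real_of_int q) * real_of_int y - real_of_int x\<rceil>)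
     else (y, \<lceil>- (real_of_int p / real_of_int q) * real_of_int y - real_of_int x\<rceil>))"

definition Fminus :: "int \<Rightarrow> int \<Rightarrow> int \<times> int \<Rightarrow> int \<times> int" where
  "Fminus p q = (\<lambda>(x, y).
     if y > 0 \<and> [y = 0] (mod q)
     then (y, 1 + \<lceil>- (real_of_int p / real_of_int q) * real_of_int y - real_of_int x\<rceil>)
     else (y, \<lceil>- (real_of_int p / real_of_int q) * real_of_int y - real_of_int x\<rceil>))"

end

theory Submission imports Defs begin

text \<open>
  The inequalities defining the sequence are affine in \<open>\<lambda>\<close>, so the parameters producing a given
  sequence form an interval, and periodic sequences are determined by their period. It remains to
  see that only finitely many sequences occur, which by compactness is a local question on
  \<open>[-2 + \<epsilon>, 2]\<close>. Close to \<open>\<lambda>\<^sub>0\<close> and on one side of it, a single step of the recurrence agrees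
  with a limit map; if the orbit of the limit map is finite, finitely many such agreements force
  the whole sequence to be constant in \<open>\<lambda>\<close> there. For \<open>\<lambda>\<^sub>0 < 2\<close> finiteness of the orbit is the
  hypothesis. For \<open>\<lambda>\<^sub>0 = 2\<close> the limit map is \<open>F\<^sup>-\<close> for \<open>p/q = 2/1\<close>, which the hypotheses do not
  cover; its square preserves an exhausting family of finite sets.
\<close>

section \<open>The recurrence as a map of the plane\<close>

definition rot_step :: "real \<Rightarrow> int \<times> int \<Rightarrow> int \<times> int" where
  "rot_step l = (\<lambda>(x, y). (y, - \<lfloor>l * real_of_int y + real_of_int x\<rfloor>))"

lemma rot_step_funpow:
  "(rot_step l ^^ n) (x, y) = (rot_seq l x y n, rot_seq l x y (Suc n))"
  by (induction n) (simp_all add: rot_step_def)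

text \<open>A finite orbit of \<open>G\<close> visits finitely many points, so the agreements at all
  of them hold simultaneously; induction then follows the orbit. The filter \<open>F\<close> is
  arbitrary, so one-sided limits are allowed.\<close>

lemma eventually_rot_seq_eq:
  assumes step: "\<And>z. \<forall>\<^sub>F l in F. rot_step l z = G z"
    and fin: "finite (range (\<lambda>n. (G ^^ n) (x, y)))"
  shows "\<forall>\<^sub>F l in F. rot_seq l x y = (\<lambda>n. fst ((G ^^ n) (x, y)))"
proof -
  have "\<forall>\<^sub>F l in F. \<forall>z\<in>range (\<lambda>n. (G ^^ n) (x, y)). rot_step l z = G z"
    using fin step by (intro eventually_ball_finite) auto
  then show ?thesis
  proof eventually_elim
    case (elim l)
    have "(rot_step l ^^ n) (x, y) = (G ^^ n) (x, y)" for n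
      by (induction n) (use elim in auto)
    then show ?case
      by (metis fst_conv rot_step_funpow)
  qed
qed

section \<open>Periodic sequences and their blocks\<close>

lemma seq_periodic_mod:
  fixes s :: "nat \<Rightarrow> 'a"
  assumes "\<And>n. s (n + T) = s n"
  shows "s (n mod T) = s n"
proof -
  have "s (m + k * T) = s m" for m k :: nat
  proof (induction k)
    case (Suc k)
    then show ?case using assms[of "m + k * T"] by (simp add: algebra_simps)
  qed simp
  from this[of "n mod T" "n div T"] show ?thesis by simp
qed

lemma seq_periodic_finite_range:
  assumes "seq_periodic s"
  shows "finite (range s)"
proof -
  obtain T where T: "T > 0" "\<And>n. s (n + T) = s n"
    using assms by (auto simp: seq_periodic_def)
  have "s n \<in> s ` {..<T}" for n
    using seq_periodic_mod[of s T n] T by (metis imageI lessThan_iff mod_less_divisor)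
  then have "range s \<subseteq> s ` {..<T}" by auto
  then show ?thesis by (rule finite_subset) simp
qed

lemma period_length_seq_periodic:
  assumes "seq_periodic s"
  shows "period_length s > 0" "s (n + period_length s) = s n"
proof -
  have "\<exists>T. T > 0 \<and> (\<forall>n. s (n + T) = s n)"
    using assms by (simp add: seq_periodic_def)
  from LeastI_ex[OF this]
  show "period_length s > 0" "s (n + period_length s) = s n"
    unfolding period_length_def by blast+
qed

text \<open>The length of a block is the minimal period, so equal blocks give a common period and
  equal values along it. Comparing periods thus becomes comparing whole sequences.\<close>

lemma period_block_eq_iff:
  assumes "seq_periodic s" "seq_periodic t"
  shows "period_block s = period_block t \<longleftrightarrow> s = t"
proof
  assume eq: "period_block s = period_block t"
  define T where "T = period_length s"
  have "length (period_block s) = length (period_block t)"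
    using eq by simp
  then have T: "period_length t = T"
    by (simp add: period_block_def T_def)
  have per: "T > 0" "\<And>n. s (n + T) = s n" "\<And>n. t (n + T) = t n"
    using period_length_seq_periodic[OF assms(1)] period_length_seq_periodic[OF assms(2)]
    unfolding T T_def by auto
  have "s i = t i" if "i < T" for i
    using eq that by (simp add: period_block_def T T_def[symmetric])
  then have "s (n mod T) = t (n mod T)" for n
    using per by simp
  then have "s n = t n" for n
    using seq_periodic_mod[of s T n] seq_periodic_mod[of t T n] per by simp
  then show "s = t" by (rule ext)
qed simp

section \<open>Convexity and compactness in the parameter\<close>

lemma is_interval_rot_seq_eq: "is_interval {l. rot_seq l x y = a}"
unfolding is_interval_1
proof (intro ballI allI impI)
  fix l1 l2 l :: real
  assume l1: "l1 \<in> {l. rot_seq l x y = a}" and l2: "l2 \<in> {l. rot_seq l x y = a}"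
    and l: "l1 \<le> l \<and> l \<le> l2"
  have a1: "a = rot_seq l1 x y" and a2: "a = rot_seq l2 x y" using l1 l2 by auto
  note b1 = iffD1[OF rot_seq_unique a1, THEN conjunct2, THEN conjunct2, rule_format]
  note b2 = iffD1[OF rot_seq_unique a2, THEN conjunct2, THEN conjunct2, rule_format]
  have "0 \<le> real_of_int (a (n + 2)) + l * real_of_int (a (n + 1)) + real_of_int (a n) \<and>
        real_of_int (a (n + 2)) + l * real_of_int (a (n + 1)) + real_of_int (a n) < 1" for n
  \<comment> \<open>The sign decides which of \<open>l1\<close> and \<open>l2\<close> supplies the
    lower bound and which the upper one.\<close>
  proof (cases "a (n + 1) \<ge> 0")
    case True
    then have "l1 * real_of_int (a (n + 1)) \<le> l * real_of_int (a (n + 1))"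
      "l * real_of_int (a (n + 1)) \<le> l2 * real_of_int (a (n + 1))"
      using l by (auto intro: mult_right_mono)
    then show ?thesis
      using b1[of n] b2[of n] by linarith
  next
    case False
    then have "l1 * real_of_int (a (n + 1)) \<ge> l * real_of_int (a (n + 1))"
      "l * real_of_int (a (n + 1)) \<ge> l2 * real_of_int (a (n + 1))"
      using l by (auto intro: mult_right_mono_neg)
    then show ?thesis
      using b1[of n] b2[of n] by linarith
  qed
  moreover have "a 0 = x" "a 1 = y" using a1 by auto
  ultimately have "a = rot_seq l x y" unfolding rot_seq_unique by blast
  then show "l \<in> {l. rot_seq l x y = a}" by simp
qed

text \<open>The cover is of \<open>K\<close>, but values are counted on \<open>A\<close> only. A
  half-open \<open>A\<close> can thus be treated through a compact set containing it.\<close>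

lemma finite_image_compact_local:
  fixes K A :: "'a::topological_space set"
  assumes "compact K"
    and "\<And>t. t \<in> K \<Longrightarrow> \<exists>U. open U \<and> t \<in> U \<and> finite (f ` (U \<inter> A))"
  shows "finite (f ` (K \<inter> A))"
proof -
  from assms(2) obtain U where U: "\<And>t. t \<in> K \<Longrightarrow> open (U t) \<and> t \<in> U t \<and> finite (f ` (U t \<inter> A))"
    by metis
  obtain D where D: "D \<subseteq> K" "finite D" "K \<subseteq> (\<Union>t\<in>D. U t)"
    by (rule compactE_image[OF assms(1), of K U]) (use U in auto)
  have "f ` (K \<inter> A) \<subseteq> (\<Union>t\<in>D. f ` (U t \<inter> A))" using D by blast
  moreover have "finite (\<Union>t\<in>D. f ` (U t \<inter> A))" using D U by auto
  ultimately show ?thesis by (rule finite_subset)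
qed

section \<open>One-sided limits of a single step\<close>

lemma eventually_floor_affine_nonint:
  assumes "l0 * real_of_int y + real_of_int x \<notin> \<int>"
  shows "\<forall>\<^sub>F l in at l0 within S. \<lfloor>l * real_of_int y + real_of_int x\<rfloor> = \<lfloor>l0 * real_of_int y + real_of_int x\<rfloor>"
  by (rule eventually_floor_eq[OF _ assms]) (intro tendsto_intros)

text \<open>Starting from an integer value, the floor drops at once exactly when the form decreases
  in \<open>l\<close>. This is the source of the exceptional branch of \<open>Fplus\<close>.\<close>

lemma eventually_floor_affine_right:
  assumes v: "l0 * real_of_int y + real_of_int x = real_of_int v"
  shows "\<forall>\<^sub>F l in at_right l0. \<lfloor>l * real_of_int y + real_of_int x\<rfloor> = (if y < 0 then v - 1 else v)"
proof -
  have "((\<lambda>l. l * real_of_int y + real_of_int x) \<longlongrightarrow> real_of_int v) (at_right l0)"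
    unfolding v[symmetric] by (intro tendsto_intros)
  from order_tendstoD[OF this]
  have "\<forall>\<^sub>F l in at_right l0. real_of_int v - 1 < l * real_of_int y + real_of_int x"
    "\<forall>\<^sub>F l in at_right l0. l * real_of_int y + real_of_int x < real_of_int v + 1" by auto
  moreover have "\<forall>\<^sub>F l in at_right l0. l > l0" by (simp add: eventually_at_right_less)
  ultimately show ?thesis
  proof eventually_elim
    case (elim l)
    show ?case
    proof (cases "y < 0")
      case True
      then have "l * real_of_int y < l0 * real_of_int y" using elim by simp
      then have "\<lfloor>l * real_of_int y + real_of_int x\<rfloor> = v - 1" using elim v by linarith
      then show ?thesis using True by simp
    next
      case False
      then have "l0 * real_of_int y \<le> l * real_of_int y" using elim by (intro mult_right_mono) auto
      then have "\<lfloor>l * real_of_int y + real_of_int x\<rfloor> = v" using elim v by linarith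
      then show ?thesis using False by simp
    qed
  qed
qed

text \<open>Negating both \<open>l\<close> and \<open>y\<close> preserves the form and exchanges the
  two sides.\<close>

lemma eventually_floor_affine_left:
  assumes v: "l0 * real_of_int y + real_of_int x = real_of_int v"
  shows "\<forall>\<^sub>F l in at_left l0. \<lfloor>l * real_of_int y + real_of_int x\<rfloor> = (if y > 0 then v - 1 else v)"
proof -
  have "\<forall>\<^sub>F l in at_right (- l0). \<lfloor>l * real_of_int (- y) + real_of_int x\<rfloor> = (if - y < 0 then v - 1 else v)"
    using v by (intro eventually_floor_affine_right) simp
  then show ?thesis
    unfolding eventually_at_left_to_right[of _ l0] by simp
qed

text \<open>By coprimality \<open>q\<close> divides \<open>p * y\<close> only if it divides
  \<open>y\<close>. So the congruence in the limit maps marks exactly the points where the floor can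
  jump.\<close>

lemma int_affine_iff_dvd:
  assumes "q \<ge> 1" "coprime p q"
  shows "real_of_int p / real_of_int q * real_of_int y + real_of_int x \<in> \<int> \<longleftrightarrow> [y = 0] (mod q)"
proof
  assume "real_of_int p / real_of_int q * real_of_int y + real_of_int x \<in> \<int>"
  then have "real_of_int p / real_of_int q * real_of_int y + real_of_int x - real_of_int x \<in> \<int>"
    by (rule Ints_diff) simp
  then obtain k where "real_of_int p / real_of_int q * real_of_int y = real_of_int k"
    by (auto elim: Ints_cases)
  then have "real_of_int (p * y) = real_of_int (q * k)"
    using assms(1) by (simp add: field_simps)
  then have "q dvd p * y" by (metis dvd_triv_left of_int_eq_iff)
  then show "[y = 0] (mod q)"
    using assms(2) by (simp add: coprime_dvd_mult_right_iff coprime_commute cong_0_iff)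
next
  assume "[y = 0] (mod q)"
  then obtain k where "y = q * k" by (auto simp: cong_0_iff)
  then have "real_of_int p / real_of_int q * real_of_int y + real_of_int x = real_of_int (p * k + x)"
    using assms(1) by simp
  then show "real_of_int p / real_of_int q * real_of_int y + real_of_int x \<in> \<int>"
    by (simp only: Ints_of_int)
qed

lemma ceiling_minus_eq:
  "\<lceil>- l * real_of_int y - real_of_int x\<rceil> = - \<lfloor>l * real_of_int y + real_of_int x\<rfloor>"
  by (simp add: ceiling_def)

lemma eventually_rot_step_Fplus:
  assumes "q \<ge> 1" "coprime p q"
  shows "\<forall>\<^sub>F l in at_right (real_of_int p / real_of_int q). rot_step l z = Fplus p q z"
proof (cases z)
  case (Pair x y)
  define l0 where "l0 = real_of_int p / real_of_int q"
  note dvd = int_affine_iff_dvd[OF assms, of y x, folded l0_def]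
  note F = Fplus_def[of p q, folded l0_def, unfolded ceiling_minus_eq]
  show ?thesis
  proof (cases "l0 * real_of_int y + real_of_int x \<in> \<int>")
    case True
    then obtain v where v: "l0 * real_of_int y + real_of_int x = real_of_int v"
      by (rule Ints_cases)
    from eventually_floor_affine_right[OF v] show ?thesis
      unfolding l0_def[symmetric]
      by eventually_elim (use dvd True v in \<open>auto simp: Pair F rot_step_def\<close>)
  next
    case False
    from eventually_floor_affine_nonint[OF False] show ?thesis
      unfolding l0_def[symmetric]
      by eventually_elim (use dvd False in \<open>auto simp: Pair F rot_step_def\<close>)
  qed
qed

lemma eventually_rot_step_Fminus:
  assumes "q \<ge> 1" "coprime p q"
  shows "\<forall>\<^sub>F l in at_left (real_of_int p / real_of_int q). rot_step l z = Fminus p q z"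
proof (cases z)
  case (Pair x y)
  define l0 where "l0 = real_of_int p / real_of_int q"
  note dvd = int_affine_iff_dvd[OF assms, of y x, folded l0_def]
  note F = Fminus_def[of p q, folded l0_def, unfolded ceiling_minus_eq]
  show ?thesis
  proof (cases "l0 * real_of_int y + real_of_int x \<in> \<int>")
    case True
    then obtain v where v: "l0 * real_of_int y + real_of_int x = real_of_int v"
      by (rule Ints_cases)
    from eventually_floor_affine_left[OF v] show ?thesis
      unfolding l0_def[symmetric]
      by eventually_elim (use dvd True v in \<open>auto simp: Pair F rot_step_def\<close>)
  next
    case False
    from eventually_floor_affine_nonint[OF False] show ?thesis
      unfolding l0_def[symmetric]
      by eventually_elim (use dvd False in \<open>auto simp: Pair F rot_step_def\<close>)
  qed
qed

text \<open>For irrational \<open>l0\<close> the form is an integer only if \<open>y = 0\<close>,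
  and then the step does not depend on \<open>l\<close>. Hence neither side has a jump.\<close>

lemma eventually_rot_step_irrational:
  assumes "l0 \<notin> \<rat>"
  shows "\<forall>\<^sub>F l in at l0. rot_step l z = rot_step l0 z"
proof (cases z)
  case (Pair x y)
  show ?thesis
  proof (cases "y = 0")
    case False
    have "l0 * real_of_int y + real_of_int x \<notin> \<int>"
    proof
      assume "l0 * real_of_int y + real_of_int x \<in> \<int>"
      then obtain k where "l0 * real_of_int y + real_of_int x = real_of_int k"
        by (rule Ints_cases)
      then have "l0 = real_of_int (k - x) / real_of_int y" using False by (simp add: field_simps)
      then show False using assms by (metis Rats_divide Rats_of_int)
    qed
    from eventually_floor_affine_nonint[OF this] show ?thesis
      by eventually_elim (simp add: Pair rot_step_def)
  qed (simp add: Pair rot_step_def)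
qed

section \<open>The limit map at the endpoint 2\<close>

lemma Fminus_2_1: "Fminus 2 1 (x, y) = (y, (if y > 0 then 1 else 0) - 2 * y - x)"
proof -
  have "\<lceil>- (real_of_int 2 / real_of_int 1) * real_of_int y - real_of_int x\<rceil> = - 2 * y - x"
    by (simp add: ceiling_eq_iff)
  then show ?thesis by (simp add: Fminus_def)
qed

text \<open>
  For an orbit \<open>a\<close> of \<open>F\<^sup>-\<close> at \<open>2/1\<close>, put \<open>b\<^sub>n = (-1)\<^sup>n a\<^sub>n\<close> and \<open>s = b\<^sub>2\<^sub>k\<^sub>+\<^sub>1 - b\<^sub>2\<^sub>k\<close>. While
  \<open>b > 0\<close> the slope drops by 1 every second step and \<open>s\<^sup>2 + s + b\<^sub>2\<^sub>k\<close> is conserved; while \<open>b < 0\<close> it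
  rises by 1 and \<open>s\<^sup>2 - b\<^sub>2\<^sub>k\<close> is conserved. A change of sign may alter the energy, but never beyond
  a threshold of the form \<open>M\<^sup>2 + M\<close>. Below, \<open>s = - (x + y)\<close>.
\<close>

definition trap :: "int \<Rightarrow> (int \<times> int) set" where
  "trap M = {(x, y). if x > 0 then (x + y)\<^sup>2 - (x + y) + x \<le> M\<^sup>2 + M
                     else (x + y)\<^sup>2 - x \<le> M\<^sup>2 + M}"

text \<open>Both sides are products of consecutive integers, \<open>m * (m - 1)\<close> and
  \<open>(M + 1) * M\<close>, so \<open>m \<ge> M + 1\<close> would violate the strict inequality.
  This explains the shape of the threshold in \<open>trap\<close>.\<close>

lemma int_square_bound:
  fixes m M :: int
  assumes "m\<^sup>2 - m < M\<^sup>2 + M" "M \<ge> 0"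
  shows "m \<le> M"
proof (rule ccontr)
  assume "\<not> m \<le> M"
  then have "(M + 1) * M \<le> m * (m - 1)" using assms(2) by (intro mult_mono) auto
  then show False using assms(1) by (simp add: power2_eq_square algebra_simps)
qed

text \<open>The new energy is computed from the old one. If the branch changes, a bound on one
  energy first bounds the slope by \<open>M\<close>, and this bounds the other energy by the same
  threshold.\<close>

lemma trap_invariant:
  assumes M: "M \<ge> 0" and z: "z \<in> trap M"
  shows "Fminus 2 1 (Fminus 2 1 z) \<in> trap M"
proof -
  obtain x y where xy: "z = (x, y)" by (cases z)
  define s where "s = - x - y"
  have y: "y = - x - s" by (simp add: s_def)
  have up: "s \<le> M" if "s\<^sup>2 - s < M\<^sup>2 + M" using int_square_bound[OF that M] .
  have low: "- s \<le> M" if "s\<^sup>2 + s < M\<^sup>2 + M"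
    using int_square_bound[of "- s" M] that M by simp
  have mono: "s\<^sup>2 + s \<le> M\<^sup>2 + M" if "0 \<le> s" "s \<le> M"
    using that by (simp add: power_mono add_mono)
  have mono': "s\<^sup>2 - s \<le> M\<^sup>2 + M" if "0 \<le> - s" "- s \<le> M"
    using power_mono[of "- s" M 2] that by simp
  have in_trap: "(u, v) \<in> trap M \<longleftrightarrow>
      (if u > 0 then (u + v)\<^sup>2 - (u + v) + u \<le> M\<^sup>2 + M else (u + v)\<^sup>2 - u \<le> M\<^sup>2 + M)" for u v
    by (simp add: trap_def)
  have inv: "if x > 0 then s\<^sup>2 + s + x \<le> M\<^sup>2 + M else s\<^sup>2 - x \<le> M\<^sup>2 + M"
    using z unfolding xy in_trap y by (simp split: if_splits)
  \<comment> \<open>The cases are the signs of the next two values of \<open>b\<close>, which decide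
    where the correction 1 is added. The slope drops by 1 in A, rises by 1 in B, and is unchanged in
    C and D.\<close>
  consider (A) "x + s \<ge> 0" "x + 2 * s > 0" | (B) "x + s < 0" "x + 2 * s + 1 \<le> 0"
    | (C) "x + s \<ge> 0" "x + 2 * s \<le> 0" | (D) "x + s < 0" "x + 2 * s + 1 > 0" by linarith
  then show ?thesis
  proof cases
    case A
    then have F: "Fminus 2 1 (Fminus 2 1 z) = (x + 2 * s, 1 - x - 3 * s)"
      by (simp add: xy y Fminus_2_1)
    \<comment> \<open>If \<open>x \<le> 0\<close>, then \<open>s > 0\<close> and the other energy
      gives \<open>s \<le> M\<close> through \<open>up\<close>.\<close>
    have "s\<^sup>2 + s + x \<le> M\<^sup>2 + M"
      using inv A up mono by (auto split: if_splits)
    then show ?thesis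
      using A unfolding F in_trap by (simp add: power2_eq_square algebra_simps)
  next
    case B
    then have F: "Fminus 2 1 (Fminus 2 1 z) = (x + 2 * s + 1, - x - 3 * s - 2)"
      by (simp add: xy y Fminus_2_1)
    have "s\<^sup>2 - x \<le> M\<^sup>2 + M"
      using inv B low mono' by (auto split: if_splits)
    then show ?thesis
      using B unfolding F in_trap by (simp add: power2_eq_square algebra_simps)
  next
    case C
    then have F: "Fminus 2 1 (Fminus 2 1 z) = (x + 2 * s, - x - 3 * s)"
      by (simp add: xy y Fminus_2_1)
    have "s\<^sup>2 - x - 2 * s \<le> M\<^sup>2 + M"
      using inv C low mono' by (auto split: if_splits)
    then show ?thesis
      using C unfolding F in_trap by (simp add: power2_eq_square algebra_simps)
  next
    case D
    then have F: "Fminus 2 1 (Fminus 2 1 z) = (x + 2 * s + 1, - x - 3 * s - 1)"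
      by (simp add: xy y Fminus_2_1)
    have x: "x \<le> 0" "s \<ge> 0" using D by auto
    \<comment> \<open>Here \<open>- x \<ge> s + 1\<close>, so \<open>s \<ge> M\<close> would push
      \<open>s\<^sup>2 - x\<close> above the threshold. The strict bound is wanted because the new
      energy is \<open>(s + 1)\<^sup>2 + (x + s)\<close>.\<close>
    have "s < M"
    proof (rule ccontr)
      assume "\<not> s < M"
      then have "M\<^sup>2 \<le> s\<^sup>2" using M by (intro power_mono) auto
      then show False using inv x D \<open>\<not> s < M\<close> by (auto split: if_splits)
    qed
    then have "(s + 1)\<^sup>2 \<le> M\<^sup>2" using x by (intro power_mono) auto
    then have "s\<^sup>2 + s + (x + 2 * s + 1) \<le> M\<^sup>2 + M"
      using D M by (simp add: power2_eq_square algebra_simps)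
    then show ?thesis
      using D unfolding F in_trap by (simp add: power2_eq_square algebra_simps)
  qed
qed

text \<open>An integer \<open>u\<close> satisfies \<open>u\<^sup>2 \<ge> \<bar>u\<bar>\<close>, so
  either energy is at least \<open>\<bar>x\<bar>\<close>; with \<open>x\<close> bounded, the energy
  also bounds \<open>x + y\<close>.\<close>

lemma finite_trap: "finite (trap M)"
proof -
  define K where "K = M\<^sup>2 + M"
  have "(x, y) \<in> {- K..K} \<times> {- 2 * K - 1..2 * K + 1}" if "(x, y) \<in> trap M" for x y
  proof -
    have sq: "(x + y)\<^sup>2 \<ge> \<bar>x + y\<bar>" "(x + y - 1)\<^sup>2 \<ge> 0"
      using self_le_power[of "\<bar>x + y\<bar>" 2] by (cases "x + y = 0"; simp)+
    have "(x + y - 1)\<^sup>2 = (x + y)\<^sup>2 - 2 * (x + y) + 1"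
      by (simp add: power2_eq_square algebra_simps)
    then show ?thesis
      using that sq by (auto simp: trap_def K_def[symmetric] split: if_splits)
  qed
  then have "trap M \<subseteq> {- K..K} \<times> {- 2 * K - 1..2 * K + 1}" by auto
  then show ?thesis by (rule finite_subset) simp
qed

lemma ex_trap: "\<exists>M\<ge>0. z \<in> trap M"
proof -
  obtain x y where z: "z = (x, y)" by (cases z)
  \<comment> \<open>Both energies are at most
    \<open>(x + y)\<^sup>2 + \<bar>x + y\<bar> + \<bar>x\<bar>\<close>, hence at most
    \<open>M\<^sup>2 + M\<close>.\<close>
  define M where "M = \<bar>x\<bar> + \<bar>x + y\<bar>"
  have "\<bar>x + y\<bar>\<^sup>2 \<le> M\<^sup>2" by (intro power_mono) (auto simp: M_def)
  then have "(x + y)\<^sup>2 \<le> M\<^sup>2" by simp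
  then have "z \<in> trap M" by (auto simp: z trap_def M_def)
  moreover have "M \<ge> 0" by (simp add: M_def)
  ultimately show ?thesis by blast
qed

lemma finite_orbit_Fminus_2_1: "finite (range (\<lambda>n. (Fminus 2 1 ^^ n) z))"
proof -
  obtain M where M: "M \<ge> 0" "z \<in> trap M" using ex_trap by blast
  have even: "(Fminus 2 1 ^^ (2 * k)) z \<in> trap M" for k
    by (induction k) (use M trap_invariant in auto)
  \<comment> \<open>Only the square of the map preserves the trap, so odd iterates are caught in its
    image.\<close>
  have "(Fminus 2 1 ^^ n) z \<in> trap M \<union> Fminus 2 1 ` trap M" for n
  proof (cases "even n")
    case True
    then show ?thesis using even by (auto elim: evenE)
  next
    case False
    then obtain k where "n = Suc (2 * k)" by (auto elim: oddE)
    then show ?thesis using even[of k] by auto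
  qed
  then have "range (\<lambda>n. (Fminus 2 1 ^^ n) z) \<subseteq> trap M \<union> Fminus 2 1 ` trap M" by blast
  then show ?thesis by (rule finite_subset) (simp add: finite_trap)
qed

section \<open>Local finiteness and the decomposition into intervals\<close>

lemma locally_finite_image:
  fixes f :: "real \<Rightarrow> 'a"
  assumes "\<forall>\<^sub>F l in at_left t. l \<in> A \<longrightarrow> f l = u" "\<forall>\<^sub>F l in at_right t. l \<in> A \<longrightarrow> f l = v"
  shows "\<exists>U. open U \<and> t \<in> U \<and> finite (f ` (U \<inter> A))"
proof -
  have "\<forall>\<^sub>F l in at t. l \<in> A \<longrightarrow> f l \<in> {u, v, f t}"
    unfolding eventually_at_split using assms by (auto elim: eventually_mono)
  then have "\<forall>\<^sub>F l in nhds t. l \<in> A \<longrightarrow> f l \<in> {u, v, f t}"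
    by (simp add: eventually_nhds_conv_at)
  then obtain U where U: "open U" "t \<in> U" "\<forall>l\<in>U. l \<in> A \<longrightarrow> f l \<in> {u, v, f t}"
    unfolding eventually_nhds by blast
  then have "f ` (U \<inter> A) \<subseteq> {u, v, f t}" by blast
  then show ?thesis using U finite_subset by blast
qed

theorem theorem1:
  fixes a0 a1 :: int and \<epsilon> :: real
  assumes rot_periodic:
      "\<And>(l::real) (x::int) (y::int). -2 < l \<Longrightarrow> l < 2 \<Longrightarrow> seq_periodic (rot_seq l x y)"
    and Fplus_periodic:
      "\<And>(p::int) (q::int) (z::int \<times> int). q \<ge> 1 \<Longrightarrow> coprime p q \<Longrightarrow>
         -2 < real_of_int p / real_of_int q \<Longrightarrow> real_of_int p / real_of_int q < 2 \<Longrightarrow>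
         seq_periodic (\<lambda>n. (Fplus p q ^^ n) z)"
    and Fminus_periodic:
      "\<And>(p::int) (q::int) (z::int \<times> int). q \<ge> 1 \<Longrightarrow> coprime p q \<Longrightarrow>
         -2 < real_of_int p / real_of_int q \<Longrightarrow> real_of_int p / real_of_int q < 2 \<Longrightarrow>
         seq_periodic (\<lambda>n. (Fminus p q ^^ n) z)"
    and eps: "\<epsilon> > 0"
  shows "\<exists>(m::nat) (I :: nat \<Rightarrow> real set).
      (\<forall>j<m. I j \<noteq> {} \<and> is_interval (I j)) \<and>
      disjoint_family_on I {..<m} \<and>
      (\<Union>j<m. I j) = {-2 + \<epsilon>..<2} \<and>
      (\<forall>j<m. \<forall>l\<in>I j. \<forall>l'\<in>I j.
         period_block (rot_seq l a0 a1) = period_block (rot_seq l' a0 a1)) \<and>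
      (\<forall>j<m. \<forall>j'<m. j \<noteq> j' \<longrightarrow> (\<forall>l\<in>I j. \<forall>l'\<in>I j'.
         period_block (rot_seq l a0 a1) \<noteq> period_block (rot_seq l' a0 a1)))"
proof -
  define A where "A = {-2 + \<epsilon>..<2}"
  define f where "f = (\<lambda>l. rot_seq l a0 a1)"
  \<comment> \<open>The point \<open>t\<close> ranges over a compact interval including 2, although
    only parameters in \<open>A\<close> matter.\<close>
  have one_sided: "\<exists>u v. (\<forall>\<^sub>F l in at_left t. l \<in> A \<longrightarrow> f l = u) \<and> (\<forall>\<^sub>F l in at_right t. l \<in> A \<longrightarrow> f l = v)"
    if t: "t \<in> {-2 + \<epsilon>..2}" for t
  proof (cases "t = 2")
    case True
    have "\<forall>\<^sub>F l in at_left t. rot_step l z = Fminus 2 1 z" for z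
      using eventually_rot_step_Fminus[of 1 2 z] True by simp
    from eventually_rot_seq_eq[OF this finite_orbit_Fminus_2_1, of a0 a1]
    have "\<forall>\<^sub>F l in at_left t. l \<in> A \<longrightarrow> f l = (\<lambda>n. fst ((Fminus 2 1 ^^ n) (a0, a1)))"
      by (auto simp: f_def elim: eventually_mono)
    \<comment> \<open>\<open>A\<close> has no points to the right of 2, so the value
      \<open>f t\<close> is a placeholder.\<close>
    moreover have "\<forall>\<^sub>F l in at_right t. l \<in> A \<longrightarrow> f l = f t"
      using eventually_at_right_less[of t]
      by (rule eventually_mono) (use True in \<open>simp add: A_def\<close>)
    ultimately show ?thesis by blast
  next
    case False
    with t eps have t: "-2 < t" "t < 2" by auto
    show ?thesis
    proof (cases "t \<in> \<rat>")
      case True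
      then obtain p q where pq: "q \<ge> 1" "coprime p q" "t = real_of_int p / real_of_int q"
        by (metis Rats_cases' int_one_le_iff_zero_less)
      have lf: "\<forall>\<^sub>F l in at_left t. f l = (\<lambda>n. fst ((Fminus p q ^^ n) (a0, a1)))"
        unfolding f_def pq(3)
        using pq t eventually_rot_step_Fminus Fminus_periodic
        by (intro eventually_rot_seq_eq seq_periodic_finite_range) auto
      have rt: "\<forall>\<^sub>F l in at_right t. f l = (\<lambda>n. fst ((Fplus p q ^^ n) (a0, a1)))"
        unfolding f_def pq(3)
        using pq t eventually_rot_step_Fplus Fplus_periodic
        by (intro eventually_rot_seq_eq seq_periodic_finite_range) auto
      from lf rt show ?thesis by (blast intro: eventually_mono)
    next
      case False
      obtain T where "T > 0" "\<And>n. rot_seq t a0 a1 (n + T) = rot_seq t a0 a1 n"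
        using rot_periodic[OF t, of a0 a1] unfolding seq_periodic_def by blast
      \<comment> \<open>A period of the sequence is also a period of its pairs of consecutive
        terms.\<close>
      then have "seq_periodic (\<lambda>n. (rot_step t ^^ n) (a0, a1))"
        unfolding seq_periodic_def rot_step_funpow by (metis add_Suc)
      then have "\<forall>\<^sub>F l in at t. f l = (\<lambda>n. fst ((rot_step t ^^ n) (a0, a1)))"
        unfolding f_def
        by (intro eventually_rot_seq_eq seq_periodic_finite_range eventually_rot_step_irrational False)
      then show ?thesis unfolding eventually_at_split by (blast intro: eventually_mono)
    qed
  qed
  have "\<exists>U. open U \<and> t \<in> U \<and> finite (f ` (U \<inter> A))" if "t \<in> {-2 + \<epsilon>..2}" for t
  proof -
    from one_sided[OF that] obtain u v where
      "\<forall>\<^sub>F l in at_left t. l \<in> A \<longrightarrow> f l = u" "\<forall>\<^sub>F l in at_right t. l \<in> A \<longrightarrow> f l = v" by blast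
    then show ?thesis by (rule locally_finite_image)
  qed
  from finite_image_compact_local[OF compact_Icc this]
  have "finite (f ` ({-2 + \<epsilon>..2} \<inter> A))" by blast
  moreover have "{-2 + \<epsilon>..2} \<inter> A = A" by (auto simp: A_def)
  ultimately have "finite (f ` A)" by simp
  \<comment> \<open>The finitely many sequences are numbered, and each \<open>I j\<close> is the
    fibre of \<open>f\<close> over one of them. For \<open>\<epsilon> \<ge> 4\<close> the set
    \<open>A\<close> is empty and \<open>m = 0\<close>.\<close>
  then obtain h where h: "bij_betw h {..<card (f ` A)} (f ` A)"
    using ex_bij_betw_nat_finite[of "f ` A"] by (auto simp: atLeast0LessThan)
  define m where "m = card (f ` A)"
  define I where "I = (\<lambda>j. {l \<in> A. f l = h j})"
  have inj: "h i = h j \<longleftrightarrow> i = j" if "i < m" "j < m" for i j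
    using h that unfolding m_def bij_betw_def inj_on_def by blast
  have img: "h ` {..<m} = f ` A" using h by (simp add: bij_betw_def m_def)
  have block: "period_block (rot_seq l a0 a1) = period_block (rot_seq l' a0 a1) \<longleftrightarrow> f l = f l'"
    if "l \<in> A" "l' \<in> A" for l l'
    unfolding f_def using that eps
    by (intro period_block_eq_iff rot_periodic) (auto simp: A_def)
  have "I j \<noteq> {} \<and> is_interval (I j)" if "j < m" for j
  proof
    have "h j \<in> f ` A" using img that by blast
    then show "I j \<noteq> {}" by (auto simp: I_def)
    have "I j = A \<inter> {l. rot_seq l a0 a1 = h j}" by (auto simp: I_def f_def)
    moreover have "is_interval A" by (simp add: A_def)
    ultimately show "is_interval (I j)" by (simp add: is_interval_Int is_interval_rot_seq_eq)
  qed
  moreover have "disjoint_family_on I {..<m}"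
    by (auto simp: disjoint_family_on_def I_def inj)
  moreover have "(\<Union>j<m. I j) = {-2 + \<epsilon>..<2}"
    using img unfolding A_def[symmetric] I_def by auto
  moreover have "\<forall>j<m. \<forall>l\<in>I j. \<forall>l'\<in>I j.
         period_block (rot_seq l a0 a1) = period_block (rot_seq l' a0 a1)"
    by (auto simp: I_def block)
  moreover have "\<forall>j<m. \<forall>j'<m. j \<noteq> j' \<longrightarrow> (\<forall>l\<in>I j. \<forall>l'\<in>I j'.
         period_block (rot_seq l a0 a1) \<noteq> period_block (rot_seq l' a0 a1))"
    by (auto simp: I_def block inj)
  ultimately show ?thesis by blast
qed

end
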